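(* Let $W=(w_{i,j})\in\mathbb{R}_+^{n\times k}$ and $\varepsilon\ge0$. For every sequence $\Theta=\{i_1\to\cdots\to i_\theta\}$ in $[n]$, the aggregated mixing inequality derived from $\Theta$, $$\sum_{j\in[k]}\Big(y_j+\sum_{s\in[\tau_j]}(w_{j_s,j}-w_{j_{s+1},j})z_{j_s}\Big)-\min\{\varepsilon,L_{W,\Theta}\}\,z_{i_\theta}\ \ge\ \sum_{j\in[k]}\max\{w_{i,j}:i\in\Theta\},$$ is valid for $\mathcal{M}(W,\mathbf 0,\varepsilon)$, i.e. it is satisfied by every $(y,z)\in\mathcal{M}(W,\mathbf 0,\varepsilon)$.
   Context: $n,k\ge1$ are integers and $[n]=\{1,\dots,n\}$. $\mathcal{M}(W,\mathbf 0,\varepsilon)=\{(y,z)\in\mathbb{R}^k\times\{0,1\}^n:\ y_j+w_{i,j}z_i\ge w_{i,j}\ \forall i\in[n],j\in[k];\ y_j\ge0\ \forall j\in[k];\ \sum_{j\in[k]}y_j\ge\varepsilon\}$. A sequence $\Theta=\{i_1\to\cdots\to i_\theta\}$ in $[n]$ is an ordered list of $\theta$ distinct indices of $[n]$, $1\le\theta\le n$; $i_p$ precedes $i_q$ in $\Theta$ if $p<q$. For $j\in[k]$ the $j$-mixing-subsequence $\{j_1\to\cdots\to j_{\tau_j}\}$ of $\Theta$ is the subsequence consisting of all $i^*\in\Theta$ with $w_{i^*,j}\ge\max\{w_{i,j}: i^*\text{ precedes } i\text{ in }\Theta\}$, where the maximum over the empty set is $0$ (so $i_\theta$ always belongs to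 it); set $w_{j_{\tau_j+1},j}:=0$. Define $$L_{W,\Theta}=\min\Big\{\sum_{j\in[k]}w_{i_\theta,j},\ \min_{1\le t<\theta}\sum_{j\in[k]}\min\{w_{i_t,j},\max\{w_{i,j}: i_t\text{ precedes }i\text{ in }\Theta\}\}\Big\}.$$ *)

theory Defs
  imports "HOL-Analysis.Finite_Cartesian_Product"
begin

text \<open>
  The index sets $[n]$ and $[k]$ are the finite (hence nonempty) types \<open>'n\<close> and \<open>'k\<close>;
  \<open>W $ i $ j\<close> is $w_{i,j}$. A sequence in $[n]$ is a nonempty distinct list over \<open>'n\<close>, and
  its positions are counted from 0.
\<close>

definition mixing_set :: "real^'k^'n \<Rightarrow> real \<Rightarrow> ((real^'k) \<times> (real^'n)) set" where
  "mixing_set W \<epsilon> = {(y, z).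
     (\<forall>i. z $ i \<in> {0, 1}) \<and>
     (\<forall>i j. y $ j + W $ i $ j * z $ i \<ge> W $ i $ j) \<and>
     (\<forall>j. y $ j \<ge> 0) \<and>
     (\<Sum>j\<in>UNIV. y $ j) \<ge> \<epsilon>}"

definition is_sequence :: "'n list \<Rightarrow> bool" where
  "is_sequence \<Theta> \<longleftrightarrow> \<Theta> \<noteq> [] \<and> distinct \<Theta>"

definition precedes :: "'n list \<Rightarrow> 'n \<Rightarrow> 'n \<Rightarrow> bool" where
  "precedes \<Theta> a b \<longleftrightarrow> (\<exists>p q. p < q \<and> q < length \<Theta> \<and> \<Theta> ! p = a \<and> \<Theta> ! q = b)"

text \<open>The maximum over the empty set is 0 here, since \<open>Max {}\<close> is unspecified.\<close>

definition max_after :: "real^'k^'n \<Rightarrow> 'n list \<Rightarrow> 'n \<Rightarrow> 'k \<Rightarrow> real" where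
  "max_after W \<Theta> a j =
     (if {i. precedes \<Theta> a i} = {} then 0 else Max {W $ i $ j | i. precedes \<Theta> a i})"

definition mixing_subseq :: "real^'k^'n \<Rightarrow> 'n list \<Rightarrow> 'k \<Rightarrow> 'n list" where
  "mixing_subseq W \<Theta> j = filter (\<lambda>a. W $ a $ j \<ge> max_after W \<Theta> a j) \<Theta>"

text \<open>
  \<open>subseq_weight W \<Theta> j s\<close> is $w_{j_{s+1},j}$ (the shift is due to counting from 0),
  including the convention $w_{j_{\tau_j+1},j} = 0$.
\<close>

definition subseq_weight :: "real^'k^'n \<Rightarrow> 'n list \<Rightarrow> 'k \<Rightarrow> nat \<Rightarrow> real" where
  "subseq_weight W \<Theta> j s =
     (if s < length (mixing_subseq W \<Theta> j) then W $ (mixing_subseq W \<Theta> j ! s) $ j else 0)"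

text \<open>
  The two nested minima are merged into one, so that the inner minimum, which ranges over
  the empty set for a sequence of length 1, is simply absent in that case.
\<close>

definition L_bound :: "real^'k^'n \<Rightarrow> 'n list \<Rightarrow> real" where
  "L_bound W \<Theta> =
     Min (insert (\<Sum>j\<in>UNIV. W $ last \<Theta> $ j)
       {(\<Sum>j\<in>UNIV. min (W $ (\<Theta> ! t) $ j) (max_after W \<Theta> (\<Theta> ! t) j)) | t. t < length \<Theta> - 1})"

end

theory Submission
  imports Defs
begin

text \<open>
  Fix a coordinate \<open>j\<close>. The coefficients of the \<open>j\<close>-mixing-subsequence telescope, so that, if the
  list is built up from its end, the element \<open>a\<close> put in front of \<open>xs\<close> contributes
  \<open>max 0 (w\<^sub>a - M) * z\<^sub>a\<close> to the mixing sum, where \<open>M\<close> is the largest weight in \<open>xs\<close>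
  (\<open>mixing_sum_Cons\<close>). This is \<open>z\<^sub>a\<close> times the amount by which \<open>a\<close> raises the maximum. Hence the
  mixing sum equals the maximal weight if all \<open>z\<^sub>i\<close> are 1, and each \<open>z\<^sub>a = 0\<close> loses the rise caused
  by \<open>a\<close>; the constraint \<open>y\<^sub>j \<ge> w\<^sub>a\<close> has to pay for that loss.

  The point is how much of \<open>y\<^sub>j\<close> is left after all losses are paid. If \<open>z\<close> is 1 on a final segment
  \<open>qs\<close> of the sequence, then at least \<open>min y\<^sub>j M\<close> is left, where \<open>M\<close> is now the largest weight in
  \<open>qs\<close> (\<open>mixing_slack\<close>): the total loss is at most the highest weight \<open>w\<^sub>a\<close> with \<open>z\<^sub>a = 0\<close>, which
  \<open>y\<^sub>j\<close> covers, and the losses only concern rises above \<open>M\<close>.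

  It remains to choose \<open>qs\<close>. If \<open>z\<close> vanishes at the last index of the sequence, the correction term
  vanishes and the empty \<open>qs\<close> gives a nonnegative slack. If \<open>z\<close> is 1 on the whole sequence, nothing
  is lost, and the slacks sum to \<open>\<Sum>\<^sub>j y\<^sub>j \<ge> \<epsilon>\<close>. Otherwise let \<open>t\<close> be the last index of the sequence
  with \<open>z\<^sub>t = 0\<close> and \<open>qs\<close> the part after it. Then \<open>y\<^sub>j \<ge> w\<^sub>t\<close>, so the slack in coordinate \<open>j\<close> is at
  least the minimum of \<open>w\<^sub>t\<close> and the largest weight after \<open>t\<close>. The sum of these minima over \<open>j\<close> is
  one of the terms whose minimum defines \<open>L_bound\<close>.
\<close>

section \<open>Maximal weights of final segments\<close>

text \<open>
  The 0 in the set encodes the convention for the empty list and changes nothing otherwise, the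
  weights being nonnegative. It makes the recursion \<open>peak_Cons\<close> uniform.
\<close>

definition peak :: "real^'k^'n \<Rightarrow> 'n list \<Rightarrow> 'k \<Rightarrow> real" where
  "peak W xs j = Max (insert 0 ((\<lambda>i. W $ i $ j) ` set xs))"

lemma peak_Nil: "peak W [] j = 0"
  by (simp add: peak_def)

lemma peak_Cons: "peak W (a # xs) j = max (W $ a $ j) (peak W xs j)"
proof -
  have "peak W (a # xs) j = Max (insert (W $ a $ j) (insert 0 ((\<lambda>i. W $ i $ j) ` set xs)))"
    by (simp add: peak_def insert_commute)
  also have "\<dots> = max (W $ a $ j) (peak W xs j)"
    unfolding peak_def by (rule Max_insert) auto
  finally show ?thesis .
qed

lemma Max_eq_peak:
  fixes W :: "real^'k^'n"
  assumes "\<forall>i j. W $ i $ j \<ge> 0" and "xs \<noteq> []"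
  shows "Max {W $ i $ j | i. i \<in> set xs} = peak W xs j"
proof -
  have eq: "{W $ i $ j | i. i \<in> set xs} = (\<lambda>i. W $ i $ j) ` set xs"
    by auto
  have "Max ((\<lambda>i. W $ i $ j) ` set xs) \<ge> 0"
    using assms by (auto simp: Max_ge_iff neq_Nil_conv)
  then show ?thesis
    unfolding eq peak_def using assms(2) by (simp add: Max_insert)
qed

lemma precedes_split:
  assumes "distinct (ps @ a # qs)"
  shows "precedes (ps @ a # qs) a i \<longleftrightarrow> i \<in> set qs"
proof
  let ?xs = "ps @ a # qs"
  assume "precedes ?xs a i"
  then obtain p q where pq: "p < q" "q < length ?xs" "?xs ! p = a" "?xs ! q = i"
    by (auto simp: precedes_def)
  have "?xs ! p = ?xs ! length ps"
    using pq by simp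
  then have "p = length ps"
    using assms pq by (subst (asm) nth_eq_iff_index_eq) auto
  then have "i = qs ! (q - Suc (length ps))" "q - Suc (length ps) < length qs"
    using pq by (auto simp: nth_append nth_Cons')
  then show "i \<in> set qs"
    by simp
next
  assume "i \<in> set qs"
  then obtain r where "r < length qs" "qs ! r = i"
    by (auto simp: in_set_conv_nth)
  then show "precedes (ps @ a # qs) a i"
    unfolding precedes_def
    by (intro exI[of _ "length ps"] exI[of _ "Suc (length ps + r)"]) (auto simp: nth_append)
qed

lemma max_after_split:
  assumes "\<forall>i j. W $ i $ j \<ge> 0" and "distinct (ps @ a # qs)"
  shows "max_after W (ps @ a # qs) a j = peak W qs j"
  unfolding max_after_def precedes_split[OF assms(2)]
  using Max_eq_peak[OF assms(1), of qs j] by (auto simp: peak_Nil)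

section \<open>The mixing sum in one coordinate\<close>

lemma mixing_subseq_Cons:
  assumes W: "\<forall>i j. W $ i $ j \<ge> 0" and d: "distinct (a # xs)"
  shows "mixing_subseq W (a # xs) j =
    (if W $ a $ j \<ge> peak W xs j then a # mixing_subseq W xs j else mixing_subseq W xs j)"
proof -
  have head: "max_after W (a # xs) a j = peak W xs j"
    using max_after_split[OF W, of "[]" a xs j] d by simp
  have tail: "max_after W (a # xs) b j = max_after W xs b j" if b: "b \<in> set xs" for b
  proof -
    obtain ps qs where "xs = ps @ b # qs"
      using split_list[OF b] by blast
    then show ?thesis
      using max_after_split[OF W, of "a # ps" b qs j] max_after_split[OF W, of ps b qs j] d
      by simp
  qed
  have "filter (\<lambda>b. max_after W (a # xs) b j \<le> W $ b $ j) xs = mixing_subseq W xs j"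
    unfolding mixing_subseq_def by (rule filter_cong) (auto simp: tail)
  then show ?thesis
    unfolding mixing_subseq_def[of W "a # xs"] by (simp add: head)
qed

text \<open>
  The mixing subsequence consists of the right-to-left maxima, so its first element has the
  largest weight of the whole list. This is what makes its coefficients telescope to the maximum.
\<close>

lemma subseq_weight_0:
  assumes W: "\<forall>i j. W $ i $ j \<ge> 0" and "distinct xs"
  shows "subseq_weight W xs j 0 = peak W xs j"
  using assms(2)
proof (induction xs)
  case Nil
  show ?case
    by (simp add: subseq_weight_def mixing_subseq_def peak_Nil)
next
  case (Cons a xs)
  then show ?case
    by (auto simp: subseq_weight_def mixing_subseq_Cons[OF W] peak_Cons)
qed

definition mixing_sum :: "real^'k^'n \<Rightarrow> real^'n \<Rightarrow> 'n list \<Rightarrow> 'k \<Rightarrow> real" where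
  "mixing_sum W z \<Theta> j = (\<Sum>s<length (mixing_subseq W \<Theta> j).
     (subseq_weight W \<Theta> j s - subseq_weight W \<Theta> j (Suc s)) * z $ (mixing_subseq W \<Theta> j ! s))"

lemma mixing_sum_Nil: "mixing_sum W z [] j = 0"
  by (simp add: mixing_sum_def mixing_subseq_def)

text \<open>
  If \<open>a\<close> is a right-to-left maximum, it becomes the first element of the mixing subsequence, and
  its coefficient is the difference to the previous first weight, i.e. to the previous maximum.
  Otherwise \<open>a\<close> is absent from the subsequence, in accordance with a rise of 0. The product with
  \<open>z\<^sub>a\<close> covers both cases at once.
\<close>

lemma mixing_sum_Cons:
  assumes W: "\<forall>i j. W $ i $ j \<ge> 0" and d: "distinct (a # xs)"
  shows "mixing_sum W z (a # xs) j =
    max 0 (W $ a $ j - peak W xs j) * z $ a + mixing_sum W z xs j"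
proof (cases "W $ a $ j \<ge> peak W xs j")
  case True
  then have sub: "mixing_subseq W (a # xs) j = a # mixing_subseq W xs j"
    by (simp add: mixing_subseq_Cons[OF W d])
  have weight_0: "subseq_weight W (a # xs) j 0 = W $ a $ j"
    by (simp add: subseq_weight_def sub)
  have weight_Suc: "subseq_weight W (a # xs) j (Suc s) = subseq_weight W xs j s" for s
    by (simp add: subseq_weight_def sub)
  have "mixing_sum W z (a # xs) j =
      (W $ a $ j - subseq_weight W xs j 0) * z $ a + mixing_sum W z xs j"
    unfolding mixing_sum_def sub
    by (simp add: sum.lessThan_Suc_shift weight_0 weight_Suc del: sum.lessThan_Suc)
  then show ?thesis
    using True d by (simp add: subseq_weight_0[OF W])
next
  case False
  then have sub: "mixing_subseq W (a # xs) j = mixing_subseq W xs j"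
    by (simp add: mixing_subseq_Cons[OF W d])
  then show ?thesis
    using False unfolding mixing_sum_def subseq_weight_def sub by simp
qed

lemma mixing_sum_ones:
  assumes W: "\<forall>i j. W $ i $ j \<ge> 0" and "distinct xs" and "\<forall>i\<in>set xs. z $ i = 1"
  shows "mixing_sum W z xs j = peak W xs j"
  using assms(2,3)
  by (induction xs) (auto simp: mixing_sum_Nil peak_Nil mixing_sum_Cons[OF W] peak_Cons max_def)

lemma mixing_sum_suffix_le:
  assumes W: "\<forall>i j. W $ i $ j \<ge> 0" and "distinct (ps @ qs)" and z: "\<forall>i. z $ i \<ge> 0"
  shows "mixing_sum W z qs j \<le> mixing_sum W z (ps @ qs) j"
  using assms(2)
proof (induction ps)
  case (Cons a ps)
  have "0 \<le> max 0 (W $ a $ j - peak W (ps @ qs) j) * z $ a"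
    using z by simp
  then show ?case
    using Cons by (simp add: mixing_sum_Cons[OF W])
qed simp

text \<open>
  Only an element \<open>a\<close> with \<open>z\<^sub>a = 0\<close> that raises the maximum can decrease the slack
  \<open>y + mixing_sum - peak\<close>. At such an \<open>a\<close>
  the new maximum is \<open>w\<^sub>a \<le> y\<close>, so the slack is at least the mixing sum, which contains that of
  \<open>qs\<close> and hence the peak of \<open>qs\<close>.
\<close>

lemma mixing_slack:
  assumes W: "\<forall>i j. W $ i $ j \<ge> 0"
    and "distinct (ps @ qs)"
    and z: "\<forall>i. z $ i \<in> {0, 1}"
    and ones: "\<forall>i\<in>set qs. z $ i = 1"
    and y: "\<forall>i. W $ i $ j \<le> y + W $ i $ j * z $ i"
  shows "min y (peak W qs j) \<le> y + mixing_sum W z (ps @ qs) j - peak W (ps @ qs) j"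
  using assms(2)
proof (induction ps)
  case Nil
  then show ?case
    using mixing_sum_ones[OF W _ ones, of j] by simp
next
  case (Cons a ps)
  then have d: "distinct (a # ps @ qs)" "distinct (ps @ qs)" "distinct qs"
    by auto
  have IH: "min y (peak W qs j) \<le> y + mixing_sum W z (ps @ qs) j - peak W (ps @ qs) j"
    using Cons.IH d(2) .
  consider "z $ a = 1 \<or> W $ a $ j \<le> peak W (ps @ qs) j"
    | "z $ a = 0" "peak W (ps @ qs) j < W $ a $ j"
    using z by fastforce
  then show ?case
  proof cases
    case 1
    then show ?thesis
      using IH by (auto simp: mixing_sum_Cons[OF W d(1)] peak_Cons max_def)
  next
    case 2
    have "W $ a $ j \<le> y"
      using y 2(1) by (metis add.right_neutral mult_zero_right)
    moreover have "\<forall>i. z $ i \<ge> 0"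
    proof
      show "z $ i \<ge> 0" for i
        using z[rule_format, of i] by auto
    qed
    then have "peak W qs j \<le> mixing_sum W z (ps @ qs) j"
      using mixing_sum_suffix_le[OF W d(2)] mixing_sum_ones[OF W d(3) ones] by metis
    ultimately show ?thesis
      using 2 by (simp add: mixing_sum_Cons[OF W d(1)] peak_Cons)
  qed
qed

section \<open>Aggregating the coordinates\<close>

lemma L_bound_le:
  assumes W: "\<forall>i j. W $ i $ j \<ge> 0" and d: "distinct (ps @ a # qs)" and "qs \<noteq> []"
  shows "L_bound W (ps @ a # qs) \<le> (\<Sum>j\<in>UNIV. min (W $ a $ j) (peak W qs j))"
proof -
  let ?xs = "ps @ a # qs"
  let ?f = "\<lambda>t. \<Sum>j\<in>UNIV. min (W $ (?xs ! t) $ j) (max_after W ?xs (?xs ! t) j)"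
  have "?f (length ps) = (\<Sum>j\<in>UNIV. min (W $ a $ j) (peak W qs j))"
    by (simp add: max_after_split[OF W d])
  moreover have "length ps < length ?xs - 1"
    using \<open>qs \<noteq> []\<close> by simp
  ultimately have "(\<Sum>j\<in>UNIV. min (W $ a $ j) (peak W qs j)) \<in> {?f t | t. t < length ?xs - 1}"
    by (intro CollectI exI[of _ "length ps"]) simp
  then show ?thesis
    unfolding L_bound_def by (intro Min_le) auto
qed

theorem theorem4p1:
  fixes W :: "real^'k^'n" and \<epsilon> :: real and \<Theta> :: "'n list"
  assumes "\<forall>i j. W $ i $ j \<ge> 0"
    and "\<epsilon> \<ge> 0"
    and "is_sequence \<Theta>"
  shows "\<forall>(y, z) \<in> mixing_set W \<epsilon>.
    (\<Sum>j\<in>UNIV. y $ j + (\<Sum>s<length (mixing_subseq W \<Theta> j).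
        (subseq_weight W \<Theta> j s - subseq_weight W \<Theta> j (Suc s)) * z $ (mixing_subseq W \<Theta> j ! s)))
      - min \<epsilon> (L_bound W \<Theta>) * z $ last \<Theta>
    \<ge> (\<Sum>j\<in>UNIV. Max {W $ i $ j | i. i \<in> set \<Theta>})"
proof -
  note W = assms(1)
  have ne: "\<Theta> \<noteq> []" and d: "distinct \<Theta>"
    using assms(3) by (auto simp: is_sequence_def)
  have bound: "min \<epsilon> (L_bound W \<Theta>) * z $ last \<Theta>
      \<le> (\<Sum>j\<in>UNIV. y $ j + mixing_sum W z \<Theta> j - peak W \<Theta> j)"
    if "(y, z) \<in> mixing_set W \<epsilon>" for y z
  proof -
    have z: "\<forall>i. z $ i \<in> {0, 1}"
      and yw: "\<And>j. \<forall>i. W $ i $ j \<le> y $ j + W $ i $ j * z $ i"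
      and y0: "\<And>j. 0 \<le> y $ j"
      and ysum: "\<epsilon> \<le> (\<Sum>j\<in>UNIV. y $ j)"
      using that by (auto simp: mixing_set_def)
    consider "z $ last \<Theta> = 0" | "\<forall>i\<in>set \<Theta>. z $ i = 1"
      | "z $ last \<Theta> = 1" "\<exists>i\<in>set \<Theta>. z $ i = 0"
      using z by fastforce
    then show ?thesis
    proof cases
      case 1
      have "0 \<le> (\<Sum>j\<in>UNIV. y $ j + mixing_sum W z \<Theta> j - peak W \<Theta> j)"
      proof (rule sum_nonneg)
        show "0 \<le> y $ j + mixing_sum W z \<Theta> j - peak W \<Theta> j" for j
          using mixing_slack[OF W _ z _ yw, of \<Theta> "[]" j] d y0[of j] by (simp add: peak_Nil)
      qed
      then show ?thesis
        using 1 by simp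
    next
      case 2
      then have "z $ last \<Theta> = 1"
        using ne by simp
      then show ?thesis
        using 2 ysum by (simp add: mixing_sum_ones[OF W d 2])
    next
      case 3
      obtain ps t qs where \<Theta>: "\<Theta> = ps @ t # qs" and t: "z $ t = 0"
        and qs: "\<forall>i\<in>set qs. z $ i \<noteq> 0"
        using split_list_last_prop[OF 3(2)] by blast
      have ones: "\<forall>i\<in>set qs. z $ i = 1"
        using qs z by fastforce
      have "qs \<noteq> []"
        using 3(1) t by (auto simp: \<Theta>)
      then have "L_bound W \<Theta> \<le> (\<Sum>j\<in>UNIV. min (W $ t $ j) (peak W qs j))"
        using L_bound_le[OF W] d by (simp add: \<Theta>)
      also have "\<dots> \<le> (\<Sum>j\<in>UNIV. y $ j + mixing_sum W z \<Theta> j - peak W \<Theta> j)"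
      proof (rule sum_mono)
        fix j
        have "W $ t $ j \<le> y $ j"
          using yw[of j] t by (metis add.right_neutral mult_zero_right)
        then show "min (W $ t $ j) (peak W qs j) \<le> y $ j + mixing_sum W z \<Theta> j - peak W \<Theta> j"
          using mixing_slack[OF W _ z ones yw, of "ps @ [t]" j] d by (simp add: \<Theta>)
      qed
      finally show ?thesis
        using 3(1) by simp
    qed
  qed
  show ?thesis
    unfolding Max_eq_peak[OF W ne] mixing_sum_def[symmetric]
    using bound by (fastforce simp: sum_subtractf)
qed

end
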